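(* Let $\Phi$ and $B$ be N-functions such that the Sobolev conjugate function $\Phi_*$ of $\Phi$ exists and $$\lim_{t\to 0}\frac{B(|t|)}{\Phi(|t|)}=\lim_{t\to\infty}\frac{B(|t|)}{\Phi_*(|t|)}=0.$$ If $(w_n)\subset W^{1,\Phi}(\mathbb{R}^N)$ is a sequence such that $\left(\int_{\mathbb{R}^N}\Phi(|w_n|)\,dx\right)$ and $\left(\int_{\mathbb{R}^N}\Phi_*(|w_n|)\,dx\right)$ are bounded, and for each $\epsilon>0$ we have $$\mathrm{mes}(\{x\in\mathbb{R}^N: |w_n(x)|>\epsilon\})\to 0\quad\text{as } n\to+\infty,$$ then $$\int_{\mathbb{R}^N}B(|w_n|)\,dx\to 0\quad\text{as } n\to+\infty.$$
   Context: A continuous function $\Phi:\mathbb{R}\to[0,+\infty)$ is an N-function if it is convex, even, $\Phi(t)=0\Leftrightarrow t=0$, $\lim_{t\to0}\Phi(t)/t=0$ and $\lim_{t\to+\infty}\Phi(t)/t=+\infty$. No $\Delta_2$-condition is assumed. The Sobolev conjugate function $\Phi_*$ of $\Phi$ is defined through its inverse by $\Phi_*^{-1}(t)=\int_0^t \frac{\Phi^{-1}(s)}{s^{(N+1)/N}}\,ds$ for $t>0$, when $\int_1^{+\infty}\frac{\Phi^{-1}(s)}{s^{(N+1)/N}}\,ds=+\infty$ (here $\Phi^{-1}$ is the inverse of $\Phi$ restricted to $[0,+\infty)$). "$\Phi_*$ exists" means that this definition makes sense (the integral defining $\Phi_*^{-1}(t)$ is finite for each $t>0$, and the integral over $(1,+\infty)$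 diverges). For an open set $\Omega\subset\mathbb{R}^N$, $L^{\Phi}(\Omega)=\{u\in L^1_{loc}(\Omega): \int_\Omega\Phi(|u|/\alpha)\,dx<+\infty \text{ for some }\alpha>0\}$ with the Luxemburg norm $\|u\|_\Phi=\inf\{\alpha>0:\int_\Omega\Phi(|u|/\alpha)\,dx\le1\}$, and $W^{1,\Phi}(\Omega)=\{u\in L^\Phi(\Omega): \partial u/\partial x_i\in L^\Phi(\Omega),\ i=1,\dots,N\}$ with norm $\|u\|=\|\nabla u\|_\Phi+\|u\|_\Phi$. $\mathrm{mes}$ denotes Lebesgue measure. *)

theory Defs
  imports "HOL-Analysis.Analysis"
begin

definition N_function :: "(real \<Rightarrow> real) \<Rightarrow> bool" where
  "N_function \<Phi> \<longleftrightarrow>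
     continuous_on UNIV \<Phi> \<and> (\<forall>t. 0 \<le> \<Phi> t) \<and>
     convex_on UNIV \<Phi> \<and> (\<forall>t. \<Phi> (- t) = \<Phi> t) \<and> (\<forall>t. \<Phi> t = 0 \<longleftrightarrow> t = 0) \<and>
     ((\<lambda>t. \<Phi> t / t) \<longlongrightarrow> 0) (at 0) \<and>
     filterlim (\<lambda>t. \<Phi> t / t) at_top at_top"

definition N_inverse :: "(real \<Rightarrow> real) \<Rightarrow> real \<Rightarrow> real" where
  "N_inverse \<Phi> = the_inv_into {0..} \<Phi>"

definition sobolev_integrand :: "nat \<Rightarrow> (real \<Rightarrow> real) \<Rightarrow> real \<Rightarrow> real" where
  "sobolev_integrand N \<Phi> s = N_inverse \<Phi> s / s powr ((real N + 1) / real N)"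

definition sobolev_conjugate_inverse :: "nat \<Rightarrow> (real \<Rightarrow> real) \<Rightarrow> real \<Rightarrow> real" where
  "sobolev_conjugate_inverse N \<Phi> t = (LINT s:{0<..<t}|lborel. sobolev_integrand N \<Phi> s)"

definition sobolev_conjugate_exists :: "nat \<Rightarrow> (real \<Rightarrow> real) \<Rightarrow> bool" where
  "sobolev_conjugate_exists N \<Phi> \<longleftrightarrow>
     (\<forall>t>0. (\<integral>\<^sup>+s\<in>{0<..<t}. ennreal (sobolev_integrand N \<Phi> s) \<partial>lborel) < \<infinity>) \<and>
     (\<integral>\<^sup>+s\<in>{1<..}. ennreal (sobolev_integrand N \<Phi> s) \<partial>lborel) = \<infinity>"

text \<open>
  When \<^term>\<open>sobolev_conjugate_exists N \<Phi>\<close> holds for an N-function, the function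
  \<^term>\<open>sobolev_conjugate_inverse N \<Phi>\<close> is a bijection of the half-line
  \<^term>\<open>{0..} :: real set\<close> onto itself. Its inverse is extended evenly to the real line.
\<close>

definition sobolev_conjugate :: "nat \<Rightarrow> (real \<Rightarrow> real) \<Rightarrow> real \<Rightarrow> real" where
  "sobolev_conjugate N \<Phi> t = the_inv_into {0..} (sobolev_conjugate_inverse N \<Phi>) \<bar>t\<bar>"

text \<open>Elements of the function spaces are represented by real-valued functions, not by
  equivalence classes modulo null sets.\<close>

definition locally_integrable_on :: "('a::euclidean_space \<Rightarrow> real) \<Rightarrow> 'a set \<Rightarrow> bool" where
  "locally_integrable_on u \<Omega> \<longleftrightarrow>
     (\<forall>K. compact K \<and> K \<subseteq> \<Omega> \<longrightarrow> set_integrable lebesgue K u)"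

definition orlicz_space :: "(real \<Rightarrow> real) \<Rightarrow> 'a::euclidean_space set \<Rightarrow> ('a \<Rightarrow> real) set" where
  "orlicz_space \<Phi> \<Omega> = {u. locally_integrable_on u \<Omega> \<and>
     (\<exists>\<alpha>>0. (\<integral>\<^sup>+x\<in>\<Omega>. ennreal (\<Phi> (\<bar>u x\<bar> / \<alpha>)) \<partial>lebesgue) < \<infinity>)}"

primrec C_k :: "nat \<Rightarrow> ('a::euclidean_space \<Rightarrow> real) \<Rightarrow> bool" where
  "C_k 0 f \<longleftrightarrow> continuous_on UNIV f"
| "C_k (Suc k) f \<longleftrightarrow> f differentiable_on UNIV \<and>
     (\<forall>b\<in>Basis. C_k k (\<lambda>x. frechet_derivative f (at x) b))"

definition test_functions :: "'a::euclidean_space set \<Rightarrow> ('a \<Rightarrow> real) set" where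
  "test_functions \<Omega> = {\<phi>. (\<forall>k. C_k k \<phi>) \<and>
     compact (closure {x. \<phi> x \<noteq> 0}) \<and> closure {x. \<phi> x \<noteq> 0} \<subseteq> \<Omega>}"

definition weak_partial ::
  "'a::euclidean_space set \<Rightarrow> 'a \<Rightarrow> ('a \<Rightarrow> real) \<Rightarrow> ('a \<Rightarrow> real) \<Rightarrow> bool" where
  "weak_partial \<Omega> b u v \<longleftrightarrow>
     locally_integrable_on u \<Omega> \<and> locally_integrable_on v \<Omega> \<and>
     (\<forall>\<phi>\<in>test_functions \<Omega>.
        (LINT x:\<Omega>|lebesgue. u x * frechet_derivative \<phi> (at x) b) =
        - (LINT x:\<Omega>|lebesgue. v x * \<phi> x))"

definition orlicz_sobolev_space ::
  "(real \<Rightarrow> real) \<Rightarrow> 'a::euclidean_space set \<Rightarrow> ('a \<Rightarrow> real) set" where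
  "orlicz_sobolev_space \<Phi> \<Omega> = {u \<in> orlicz_space \<Phi> \<Omega>.
     \<forall>b\<in>Basis. \<exists>v\<in>orlicz_space \<Phi> \<Omega>. weak_partial \<Omega> b u v}"

end

theory Submission
  imports Defs
begin

text \<open>
  Write \<open>\<Phi>\<^sub>*\<close> for the Sobolev conjugate of \<open>\<Phi>\<close>. The two limits make \<open>B\<close> small relative to
  \<open>\<Phi>\<close> near \<open>0\<close> and small relative to \<open>\<Phi>\<^sub>*\<close> near infinity, while \<open>B\<close> is bounded in between.
  Hence for every \<open>\<epsilon> > 0\<close> there are \<open>d > 0\<close> and \<open>K \<ge> 0\<close> such that, for all \<open>t\<close>,
  \<open>B \<bar>t\<bar> \<le> \<epsilon> * \<Phi> \<bar>t\<bar> + \<epsilon> * \<Phi>\<^sub>* \<bar>t\<bar> + K * indicator {t. d / 2 < \<bar>t\<bar>} t\<close>.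
  Integrating this at \<open>t = w n x\<close>, the first two terms contribute at most a multiple of \<open>\<epsilon>\<close> that is
  independent of \<open>n\<close>, and the third one tends to zero since \<open>w n\<close> tends to zero in measure.
  Lebesgue measurability of \<open>w n\<close> comes from its local integrability.

  Two properties of \<open>\<Phi>\<^sub>*\<close> are needed. It must be positive on the positive half-line, as otherwise the
  limit of \<open>B / \<Phi>\<^sub>*\<close> gives no upper bound for \<open>B\<close>; and it must be Borel measurable, so that
  the integral of the sum can be split. Both follow once \<open>\<Phi>\<^sub>*\<close> is known to be the inverse
  of a strictly increasing bijection of the half-line \<open>[0, \<infinity>)\<close> onto itself
  (\<open>sobolev_conjugate_inverse_strict_mono_bij\<close>). That map is the primitive of a positive function,
  with finite integral over each \<open>(0, t)\<close> and infinite integral over \<open>(1, \<infinity>)\<close>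
  (\<open>primitive_strict_mono_bij\<close>).
\<close>

section \<open>Increasing bijections of the half-line\<close>

lemma bij_betw_nonneg_reals:
  fixes f :: "real \<Rightarrow> real"
  assumes cont: "\<And>t. continuous_on {0..t} f" and mono: "strict_mono_on {0..} f"
    and zero: "f 0 = 0" and unbounded: "\<And>y. \<exists>t\<ge>0. y \<le> f t"
  shows "bij_betw f {0..} {0..}"
proof -
  have "y \<in> f ` {0..}" if "0 \<le> y" for y
  proof -
    obtain t where t: "0 \<le> t" "y \<le> f t"
      using unbounded by blast
    with cont[of t] zero that obtain x where "0 \<le> x" "x \<le> t" "f x = y"
      using IVT'[of f 0 y t] by auto
    then show ?thesis by auto
  qed
  moreover have "0 \<le> f x" if "0 \<le> x" for x
    using strict_mono_on_leD[OF mono, of 0 x] that zero by simp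
  ultimately show ?thesis
    using strict_mono_on_imp_inj_on[OF mono] by (auto simp: bij_betw_def)
qed

lemma strict_mono_on_the_inv_into:
  fixes f :: "'a::linorder \<Rightarrow> 'b::linorder"
  assumes mono: "strict_mono_on A f" and bij: "bij_betw f A B"
  shows "strict_mono_on B (the_inv_into A f)"
proof (rule strict_mono_onI)
  fix x y assume xy: "x \<in> B" "y \<in> B" "x < y"
  let ?g = "the_inv_into A f"
  have g: "?g x \<in> A" "?g y \<in> A" "f (?g x) = x" "f (?g y) = y"
    using bij xy bij_betw_the_inv_into[OF bij]
    by (auto simp: bij_betw_def intro: f_the_inv_into_f)
  show "?g x < ?g y"
  proof (rule ccontr)
    assume "\<not> ?g x < ?g y"
    then have "f (?g y) \<le> f (?g x)"
      by (intro strict_mono_on_leD[OF mono g(2,1)]) simp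
    with g xy show False by simp
  qed
qed

lemma the_inv_into_pos:
  fixes f :: "real \<Rightarrow> real"
  assumes mono: "strict_mono_on {0..} f" and bij: "bij_betw f {0..} {0..}" and "0 < t"
  shows "0 < the_inv_into {0..} f t"
proof -
  have "0 \<le> the_inv_into {0..} f 0"
    using bij_betw_the_inv_into[OF bij] by (auto simp: bij_betw_def)
  also have "\<dots> < the_inv_into {0..} f t"
    using strict_mono_onD[OF strict_mono_on_the_inv_into[OF mono bij], of 0 t] \<open>0 < t\<close> by simp
  finally show ?thesis .
qed

section \<open>N-functions\<close>

lemma N_function_strict_mono_on:
  assumes "N_function \<Phi>"
  shows "strict_mono_on {0..} \<Phi>"
proof (rule strict_mono_onI)
  fix s t :: real assume st: "s \<in> {0..}" "t \<in> {0..}" "s < t"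
  have nonneg: "\<And>t. 0 \<le> \<Phi> t" and zero: "\<And>t. \<Phi> t = 0 \<longleftrightarrow> t = 0" and conv: "convex_on UNIV \<Phi>"
    using assms unfolding N_function_def by auto
  have pos: "0 < \<Phi> t"
    using nonneg[of t] zero[of t] st by (simp add: order_less_le)
  \<comment> \<open>\<open>s\<close> is a convex combination of \<open>0\<close>, where \<open>\<Phi>\<close> vanishes, and \<open>t\<close>.\<close>
  have "\<Phi> ((1 - s / t) *\<^sub>R 0 + (s / t) *\<^sub>R t) \<le> (1 - s / t) * \<Phi> 0 + (s / t) * \<Phi> t"
    by (rule convex_onD[OF conv]) (use st in auto)
  then have "\<Phi> s \<le> (s / t) * \<Phi> t"
    using zero[of 0] st by simp
  also have "\<dots> < 1 * \<Phi> t"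
    by (rule mult_strict_right_mono) (use st pos in auto)
  finally show "\<Phi> s < \<Phi> t" by simp
qed

lemma N_function_bij_betw:
  assumes "N_function \<Phi>"
  shows "bij_betw \<Phi> {0..} {0..}"
proof (rule bij_betw_nonneg_reals)
  show "continuous_on {0..t} \<Phi>" for t
    using assms unfolding N_function_def by (auto intro: continuous_on_subset)
  show "strict_mono_on {0..} \<Phi>"
    by (rule N_function_strict_mono_on[OF assms])
  show "\<Phi> 0 = 0"
    using assms unfolding N_function_def by auto
  fix y
  have "filterlim (\<lambda>t. \<Phi> t / t) at_top at_top"
    using assms unfolding N_function_def by auto
  then have "eventually (\<lambda>t. max 0 y \<le> \<Phi> t / t \<and> 1 \<le> t) at_top"
    unfolding filterlim_at_top by (intro eventually_conj eventually_ge_at_top) blast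
  then obtain t where t: "max 0 y \<le> \<Phi> t / t" "1 \<le> t"
    using eventually_happens'[OF trivial_limit_at_top_linorder] by blast
  have "y \<le> max 0 y * t"
    using t(2) mult_left_mono[of 1 t "max 0 y"] by simp
  also have "\<dots> \<le> \<Phi> t"
    using t by (subst pos_le_divide_eq[symmetric]) auto
  finally show "\<exists>t\<ge>0. y \<le> \<Phi> t"
    using t(2) by (intro exI[of _ t]) auto
qed

section \<open>The Sobolev conjugate\<close>

text \<open>
  Strict monotonicity comes from the positivity of \<open>g\<close>, continuity from the integrability of \<open>g\<close>
  near \<open>0\<close>, and surjectivity from the divergence at infinity. The argument views \<open>G t\<close> as the mass of
  \<open>{0<..<t}\<close> under the measure with density \<open>g\<close>; since nothing is assumed of \<open>g\<close> outside the
  positive half-line, the density is cut off there.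
\<close>
lemma primitive_strict_mono_bij:
  fixes g :: "real \<Rightarrow> real"
  defines "G \<equiv> \<lambda>t. LINT s:{0<..<t}|lborel. g s"
  assumes meas: "set_borel_measurable borel {0<..} g"
    and pos: "\<And>s. 0 < s \<Longrightarrow> 0 < g s"
    and fin: "\<And>t. 0 < t \<Longrightarrow> (\<integral>\<^sup>+s\<in>{0<..<t}. ennreal (g s) \<partial>lborel) < \<infinity>"
    and inf: "(\<integral>\<^sup>+s\<in>{1<..}. ennreal (g s) \<partial>lborel) = \<infinity>"
  shows "strict_mono_on {0..} G" and "bij_betw G {0..} {0..}"
proof -
  define h where "h s = indicator {0<..} s * g s" for s
  define \<nu> where "\<nu> = density lborel (\<lambda>s. ennreal (h s))"
  have h_meas [measurable]: "h \<in> borel_measurable borel"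
    using meas by (simp add: set_borel_measurable_def h_def[abs_def])
  have h_nonneg: "0 \<le> h s" for s
    using pos[of s] by (auto simp: h_def indicator_def)
  have \<nu>: "emeasure \<nu> A = (\<integral>\<^sup>+s\<in>A. ennreal (g s) \<partial>lborel)" if "A \<in> sets borel" "A \<subseteq> {0<..}" for A
  proof -
    have "emeasure \<nu> A = (\<integral>\<^sup>+s\<in>A. ennreal (h s) \<partial>lborel)"
      unfolding \<nu>_def using that by (intro emeasure_density) auto
    also have "\<dots> = (\<integral>\<^sup>+s\<in>A. ennreal (g s) \<partial>lborel)"
      using that by (intro nn_integral_cong) (auto simp: h_def indicator_def)
    finally show ?thesis .
  qed
  have \<nu>_fin: "emeasure \<nu> {0<..<t} < \<infinity>" for t
  proof (cases "0 < t")
    case True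
    have "{0<..<t} \<subseteq> {0<..}" by auto
    then show ?thesis
      using fin[OF True] \<nu>[of "{0<..<t}"] by simp
  qed simp
  have h_int: "set_integrable lborel {0<..<t} h" for t
    unfolding set_integrable_def
  proof (rule integrableI_nonneg)
    have "(\<integral>\<^sup>+x. ennreal (indicat_real {0<..<t} x *\<^sub>R h x) \<partial>lborel) = emeasure \<nu> {0<..<t}"
      unfolding \<nu>_def
      by (subst emeasure_density) (auto intro!: nn_integral_cong simp: indicator_def)
    then show "(\<integral>\<^sup>+x. ennreal (indicat_real {0<..<t} x *\<^sub>R h x) \<partial>lborel) < \<infinity>"
      using \<nu>_fin by simp
  qed (use h_nonneg in \<open>auto simp: indicator_def\<close>)
  have G_h: "G t = (LINT s:{0<..<t}|lborel. h s)" for t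
    unfolding G_def by (rule set_lebesgue_integral_cong) (auto simp: h_def)
  have G_\<nu>: "ennreal (G t) = emeasure \<nu> {0<..<t}" for t
  proof -
    have "ennreal (G t) = (\<integral>\<^sup>+x. ennreal (indicat_real {0<..<t} x *\<^sub>R h x) \<partial>lborel)"
      unfolding G_h set_lebesgue_integral_def
      by (rule nn_integral_eq_integral[symmetric])
        (use h_int h_nonneg in \<open>auto simp: set_integrable_def indicator_def\<close>)
    also have "\<dots> = emeasure \<nu> {0<..<t}"
      unfolding \<nu>_def
      by (subst emeasure_density) (auto intro!: nn_integral_cong simp: indicator_def)
    finally show ?thesis .
  qed
  have G_nonneg: "0 \<le> G t" for t
    unfolding G_h set_lebesgue_integral_def using h_nonneg by (intro Bochner_Integration.integral_nonneg) auto
  show mono: "strict_mono_on {0..} G"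
  proof (rule strict_mono_onI)
    fix s t :: real assume st: "s \<in> {0..}" "t \<in> {0..}" "s < t"
    have "emeasure \<nu> {s<..<t} \<noteq> 0"
    proof
      assume "emeasure \<nu> {s<..<t} = 0"
      then have "(\<integral>\<^sup>+x\<in>{s<..<t}. ennreal (h x) \<partial>lborel) = 0"
        by (simp add: \<nu>_def emeasure_density)
      then have "AE x in lborel. ennreal (h x) * indicator {s<..<t} x = 0"
        by (subst (asm) nn_integral_0_iff_AE) auto
      then have "AE x in lborel. x \<notin> {s<..<t}"
      proof (rule eventually_mono)
        fix x assume x: "ennreal (h x) * indicator {s<..<t} x = 0"
        show "x \<notin> {s<..<t}"
        proof
          assume "x \<in> {s<..<t}"
          with x st pos[of x] show False by (simp add: h_def ennreal_eq_0_iff)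
        qed
      qed
      then have "emeasure lborel {s<..<t} = 0"
        by (subst (asm) AE_iff_measurable[of "{s<..<t}"]) auto
      with st show False by simp
    qed
    moreover have "emeasure \<nu> {0<..<s} + emeasure \<nu> {s<..<t} = emeasure \<nu> ({0<..<s} \<union> {s<..<t})"
      by (rule plus_emeasure) (auto simp: \<nu>_def)
    moreover have "\<dots> \<le> emeasure \<nu> {0<..<t}"
      using st by (intro emeasure_mono) (auto simp: \<nu>_def)
    ultimately have "emeasure \<nu> {0<..<s} < emeasure \<nu> {0<..<t}"
      using \<nu>_fin[of s] ennreal_add_left_cancel_less[of "emeasure \<nu> {0<..<s}" 0 "emeasure \<nu> {s<..<t}"]
      by (auto simp: order_less_le)
    then show "G s < G t"
      unfolding G_\<nu>[symmetric] using G_nonneg by (simp add: ennreal_less_iff)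
  qed
  show "bij_betw G {0..} {0..}"
  proof (rule bij_betw_nonneg_reals)
    show "strict_mono_on {0..} G" by fact
    show "G 0 = 0" by (simp add: G_def set_lebesgue_integral_def)
    \<comment> \<open>Continuity is that of the indefinite Henstock--Kurzweil integral.\<close>
    have G_HK: "G t = integral {0..t} h" for t
      unfolding G_h set_borel_integral_eq_integral(2)[OF h_int] integral_open_interval_real ..
    show "continuous_on {0..t} G" for t
      using set_borel_integral_eq_integral(1)[OF h_int, of t]
      by (subst G_HK[abs_def], intro indefinite_integral_continuous_1)
        (simp add: integrable_on_open_interval_real)
    fix y
    show "\<exists>t\<ge>0. y \<le> G t"
    proof (rule ccontr)
      assume "\<not> (\<exists>t\<ge>0. y \<le> G t)"
      then have bound: "G t \<le> y" if "0 \<le> t" for t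
        using that by (meson linear)
      have "\<infinity> = emeasure \<nu> {1<..}"
        using inf by (subst \<nu>) auto
      also have "\<dots> \<le> emeasure \<nu> (\<Union>n. {0<..<real n})"
        by (rule emeasure_mono) (auto simp: \<nu>_def intro: reals_Archimedean2)
      also have "\<dots> = (SUP n. emeasure \<nu> {0<..<real n})"
        by (rule SUP_emeasure_incseq[symmetric]) (auto simp: \<nu>_def incseq_def)
      also have "\<dots> \<le> ennreal y"
        using bound by (intro SUP_least) (simp add: G_\<nu>[symmetric] ennreal_leI)
      finally show False by (simp add: top_unique)
    qed
  qed
qed

lemma sobolev_conjugate_inverse_strict_mono_bij:
  assumes \<Phi>: "N_function \<Phi>" and ex: "sobolev_conjugate_exists N \<Phi>"
  shows "strict_mono_on {0..} (sobolev_conjugate_inverse N \<Phi>)"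
    and "bij_betw (sobolev_conjugate_inverse N \<Phi>) {0..} {0..}"
proof -
  note inv = N_function_strict_mono_on[OF \<Phi>] N_function_bij_betw[OF \<Phi>]
  have "mono_on {0<..} (N_inverse \<Phi>)"
    unfolding N_inverse_def
    by (rule mono_on_subset[OF strict_mono_on_imp_mono_on[OF strict_mono_on_the_inv_into[OF inv]]]) auto
  then have "(\<lambda>s. indicat_real {0<..} s *\<^sub>R N_inverse \<Phi> s) \<in> borel_measurable borel"
    by (subst borel_measurable_restrict_space_iff[symmetric])
      (auto intro: borel_measurable_mono_on_fnc)
  then have "(\<lambda>s. (indicat_real {0<..} s *\<^sub>R N_inverse \<Phi> s) / s powr ((real N + 1) / real N))
      \<in> borel_measurable borel"
    by measurable
  then have meas: "set_borel_measurable borel {0<..} (sobolev_integrand N \<Phi>)"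
    by (simp add: set_borel_measurable_def sobolev_integrand_def[abs_def])
  have pos: "0 < sobolev_integrand N \<Phi> s" if "0 < s" for s
    using the_inv_into_pos[OF inv that] that
    by (simp add: sobolev_integrand_def N_inverse_def)
  note * = primitive_strict_mono_bij[OF meas pos]
  show "strict_mono_on {0..} (sobolev_conjugate_inverse N \<Phi>)"
    using *(1) ex by (simp add: sobolev_conjugate_exists_def sobolev_conjugate_inverse_def[abs_def])
  show "bij_betw (sobolev_conjugate_inverse N \<Phi>) {0..} {0..}"
    using *(2) ex by (simp add: sobolev_conjugate_exists_def sobolev_conjugate_inverse_def[abs_def])
qed

lemma sobolev_conjugate_pos:
  assumes "N_function \<Phi>" "sobolev_conjugate_exists N \<Phi>" "0 < t"
  shows "0 < sobolev_conjugate N \<Phi> t"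
  using the_inv_into_pos[OF sobolev_conjugate_inverse_strict_mono_bij[OF assms(1,2)] assms(3)] assms(3)
  by (simp add: sobolev_conjugate_def)

lemma borel_measurable_sobolev_conjugate:
  assumes "N_function \<Phi>" "sobolev_conjugate_exists N \<Phi>"
  shows "sobolev_conjugate N \<Phi> \<in> borel_measurable borel"
proof -
  let ?f = "the_inv_into {0..} (sobolev_conjugate_inverse N \<Phi>)"
  have "strict_mono_on {0..} ?f"
    by (rule strict_mono_on_the_inv_into[OF sobolev_conjugate_inverse_strict_mono_bij[OF assms]])
  \<comment> \<open>\<open>?f\<close> is monotone only on the half-line; composing with \<open>max 0\<close> gives a monotone function
      on the whole line that agrees with it there.\<close>
  then have "mono (\<lambda>t. ?f (max 0 t))"
    by (intro monoI) (auto intro: strict_mono_on_leD)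
  then have [measurable]: "(\<lambda>t. ?f (max 0 t)) \<in> borel_measurable borel"
    by (rule borel_measurable_mono)
  have "(\<lambda>t. (\<lambda>t. ?f (max 0 t)) \<bar>t\<bar>) \<in> borel_measurable borel"
    by measurable
  then show ?thesis by (simp add: sobolev_conjugate_def[abs_def])
qed

section \<open>Convergence of the modulars\<close>

lemma locally_integrable_on_UNIV_borel_measurable:
  fixes u :: "'a::euclidean_space \<Rightarrow> real"
  assumes "locally_integrable_on u UNIV"
  shows "u \<in> borel_measurable lebesgue"
proof (rule borel_measurable_LIMSEQ_real)
  fix n :: nat
  show "(\<lambda>x. indicat_real (cball 0 (real n)) x *\<^sub>R u x) \<in> borel_measurable lebesgue"
    using assms unfolding locally_integrable_on_def set_integrable_def
    by (intro borel_measurable_integrable) auto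
next
  fix x :: 'a
  obtain m :: nat where "norm x \<le> real m"
    using real_arch_simple by blast
  then have "eventually (\<lambda>n. indicat_real (cball 0 (real n)) x *\<^sub>R u x = u x) sequentially"
    by (intro eventually_sequentiallyI[of m]) auto
  then show "(\<lambda>n. indicat_real (cball 0 (real n)) x *\<^sub>R u x) \<longlonglongrightarrow> u x"
    by (rule tendsto_eventually)
qed

theorem theorem1p3:
  fixes \<Phi> B :: "real \<Rightarrow> real" and w :: "nat \<Rightarrow> real ^ 'n \<Rightarrow> real"
  assumes "N_function \<Phi>" and "N_function B"
    and "sobolev_conjugate_exists CARD('n) \<Phi>"
    and "((\<lambda>t. B \<bar>t\<bar> / \<Phi> \<bar>t\<bar>) \<longlongrightarrow> 0) (at 0)"
    and "((\<lambda>t. B \<bar>t\<bar> / sobolev_conjugate CARD('n) \<Phi> \<bar>t\<bar>) \<longlongrightarrow> 0) at_top"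
    and "\<And>n. w n \<in> orlicz_sobolev_space \<Phi> UNIV"
    and "\<exists>C::real. \<forall>n. (\<integral>\<^sup>+x. ennreal (\<Phi> \<bar>w n x\<bar>) \<partial>lebesgue) \<le> ennreal C"
    and "\<exists>C::real. \<forall>n.
          (\<integral>\<^sup>+x. ennreal (sobolev_conjugate CARD('n) \<Phi> \<bar>w n x\<bar>) \<partial>lebesgue) \<le> ennreal C"
    and "\<And>\<epsilon>::real. \<epsilon> > 0 \<Longrightarrow>
          (\<lambda>n. emeasure lebesgue {x. \<bar>w n x\<bar> > \<epsilon>}) \<longlonglongrightarrow> 0"
  shows "(\<lambda>n. \<integral>\<^sup>+x. ennreal (B \<bar>w n x\<bar>) \<partial>lebesgue) \<longlonglongrightarrow> 0"
proof -
  define \<Psi> where "\<Psi> = sobolev_conjugate CARD('n) \<Phi>"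
  have \<Phi>_cont: "continuous_on UNIV \<Phi>" and \<Phi>_nonneg: "0 \<le> \<Phi> t" and \<Phi>_zero: "\<Phi> t = 0 \<longleftrightarrow> t = 0" for t
    using assms(1) unfolding N_function_def by auto
  have B_nonneg: "0 \<le> B t" and B_zero: "B t = 0 \<longleftrightarrow> t = 0" for t
    using assms(2) unfolding N_function_def by auto
  have \<Psi>_pos: "0 < \<Psi> t" if "0 < t" for t
    unfolding \<Psi>_def by (rule sobolev_conjugate_pos[OF assms(1,3) that])
  have [measurable]: "\<Phi> \<in> borel_measurable borel" "\<Psi> \<in> borel_measurable borel"
    using borel_measurable_continuous_onI[OF \<Phi>_cont] borel_measurable_sobolev_conjugate[OF assms(1,3)]
    by (simp_all add: \<Psi>_def)
  have w_meas [measurable]: "w n \<in> borel_measurable lebesgue" for n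
    using assms(6)[of n] locally_integrable_on_UNIV_borel_measurable
    by (auto simp: orlicz_sobolev_space_def orlicz_space_def)
  obtain C1 C2 :: real where
    C1: "\<And>n. (\<integral>\<^sup>+x. ennreal (\<Phi> \<bar>w n x\<bar>) \<partial>lebesgue) \<le> ennreal C1" and
    C2: "\<And>n. (\<integral>\<^sup>+x. ennreal (\<Psi> \<bar>w n x\<bar>) \<partial>lebesgue) \<le> ennreal C2"
    using assms(7,8) unfolding \<Psi>_def by blast
  \<comment> \<open>\<open>C1\<close> and \<open>C2\<close> may be negative; the summand \<open>1\<close> makes \<open>C\<close> positive.\<close>
  define C where "C = max 0 C1 + max 0 C2 + 1"
  have C_pos: "0 < C"
    by (simp add: C_def add_nonneg_pos)
  have "ennreal C1 + ennreal C2 \<le> ennreal (max 0 C1) + ennreal (max 0 C2)"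
    by (intro add_mono ennreal_leI) auto
  also have "\<dots> = ennreal (max 0 C1 + max 0 C2)"
    by (rule ennreal_plus[symmetric]) auto
  also have "\<dots> \<le> ennreal C"
    by (rule ennreal_leI) (simp add: C_def)
  finally have C_bound: "ennreal C1 + ennreal C2 \<le> ennreal C" .
  have main: "eventually (\<lambda>n. (\<integral>\<^sup>+x. ennreal (B \<bar>w n x\<bar>) \<partial>lebesgue) \<le> ennreal e) sequentially"
    if "0 < e" for e :: real
  proof -
    define \<epsilon> where "\<epsilon> = e / (2 * C)"
    have \<epsilon>: "0 < \<epsilon>" "\<epsilon> * C = e / 2"
      using C_pos that by (auto simp: \<epsilon>_def)
    obtain d where d: "0 < d" "\<And>t. t \<noteq> 0 \<Longrightarrow> \<bar>t\<bar> < d \<Longrightarrow> B \<bar>t\<bar> / \<Phi> \<bar>t\<bar> < \<epsilon>"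
      using order_tendstoD(2)[OF assms(4) \<epsilon>(1)] by (auto simp: eventually_at)
    have small: "B \<bar>t\<bar> \<le> \<epsilon> * \<Phi> \<bar>t\<bar>" if "\<bar>t\<bar> < d" for t
      using d(2)[OF _ that] \<Phi>_nonneg[of "\<bar>t\<bar>"] \<Phi>_zero[of "\<bar>t\<bar>"] B_zero[of "\<bar>t\<bar>"]
      by (cases "t = 0") (auto simp: divide_less_eq)
    obtain M where M: "\<And>t. M \<le> t \<Longrightarrow> B \<bar>t\<bar> / \<Psi> \<bar>t\<bar> < \<epsilon>"
      using order_tendstoD(2)[OF assms(5) \<epsilon>(1)] by (auto simp: eventually_at_top_linorder \<Psi>_def)
    have large: "B \<bar>t\<bar> \<le> \<epsilon> * \<Psi> \<bar>t\<bar>" if "M \<le> \<bar>t\<bar>" "t \<noteq> 0" for t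
      using M[OF that(1)] \<Psi>_pos[of "\<bar>t\<bar>"] that by (auto simp: divide_less_eq)
    define K where "K = B (max 0 M)"
    have middle: "B \<bar>t\<bar> \<le> K" if "\<bar>t\<bar> \<le> M" for t
      unfolding K_def
      using strict_mono_on_leD[OF N_function_strict_mono_on[OF assms(2)], of "\<bar>t\<bar>" "max 0 M"] that
      by auto
    have K: "0 \<le> K" by (simp add: K_def B_nonneg)
    \<comment> \<open>The level \<open>d / 2\<close> turns \<open>d \<le> \<bar>w n x\<bar>\<close> into the strict inequality of convergence
        in measure.\<close>
    define A where "A n = {x. d / 2 < \<bar>w n x\<bar>}" for n
    have A [measurable]: "A n \<in> sets lebesgue" for n
    proof -
      have "{x \<in> space lebesgue. d / 2 < \<bar>w n x\<bar>} \<in> sets lebesgue"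
        by measurable
      then show ?thesis by (simp add: A_def)
    qed
    have pointwise: "ennreal (B \<bar>w n x\<bar>) \<le> ennreal \<epsilon> * ennreal (\<Phi> \<bar>w n x\<bar>) +
        ennreal \<epsilon> * ennreal (\<Psi> \<bar>w n x\<bar>) + ennreal K * indicator (A n) x" for n x
    proof -
      consider "\<bar>w n x\<bar> < d" | "M \<le> \<bar>w n x\<bar>" "w n x \<noteq> 0" | "d \<le> \<bar>w n x\<bar>" "\<bar>w n x\<bar> \<le> M"
        using d(1) by fastforce
      then show ?thesis
      proof cases
        case 1
        have "ennreal (B \<bar>w n x\<bar>) \<le> ennreal \<epsilon> * ennreal (\<Phi> \<bar>w n x\<bar>)"
          using small[OF 1] \<epsilon>(1) by (simp add: ennreal_mult'[symmetric] ennreal_leI)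
        then show ?thesis by (simp add: add_increasing2 add.assoc)
      next
        case 2
        have "ennreal (B \<bar>w n x\<bar>) \<le> ennreal \<epsilon> * ennreal (\<Psi> \<bar>w n x\<bar>)"
          using large[OF 2] \<epsilon>(1) by (simp add: ennreal_mult'[symmetric] ennreal_leI)
        then show ?thesis by (simp add: add_increasing add_increasing2)
      next
        case 3
        have "x \<in> A n" using 3 d(1) by (simp add: A_def)
        moreover have "ennreal (B \<bar>w n x\<bar>) \<le> ennreal K"
          by (rule ennreal_leI[OF middle[OF 3(2)]])
        ultimately show ?thesis by (simp add: add_increasing)
      qed
    qed
    have bound: "(\<integral>\<^sup>+x. ennreal (B \<bar>w n x\<bar>) \<partial>lebesgue)
        \<le> ennreal (e / 2) + ennreal K * emeasure lebesgue (A n)" for n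
    proof -
      have "(\<integral>\<^sup>+x. ennreal (B \<bar>w n x\<bar>) \<partial>lebesgue) \<le>
          (\<integral>\<^sup>+x. ennreal \<epsilon> * ennreal (\<Phi> \<bar>w n x\<bar>) + ennreal \<epsilon> * ennreal (\<Psi> \<bar>w n x\<bar>) +
             ennreal K * indicator (A n) x \<partial>lebesgue)"
        by (intro nn_integral_mono pointwise)
      also have "\<dots> = ennreal \<epsilon> * ((\<integral>\<^sup>+x. ennreal (\<Phi> \<bar>w n x\<bar>) \<partial>lebesgue) +
          (\<integral>\<^sup>+x. ennreal (\<Psi> \<bar>w n x\<bar>) \<partial>lebesgue)) + ennreal K * emeasure lebesgue (A n)"
        by (simp add: nn_integral_add nn_integral_cmult distrib_left)
      also have "\<dots> \<le> ennreal \<epsilon> * ennreal C + ennreal K * emeasure lebesgue (A n)"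
        by (intro add_right_mono mult_left_mono order_trans[OF add_mono[OF C1 C2] C_bound]) simp
      also have "ennreal \<epsilon> * ennreal C = ennreal (e / 2)"
        unfolding \<epsilon>(2)[symmetric] by (rule ennreal_mult'[symmetric]) (use \<epsilon>(1) in simp)
      finally show ?thesis .
    qed
    have "(\<lambda>n. ennreal K * emeasure lebesgue (A n)) \<longlonglongrightarrow> ennreal K * 0"
      unfolding A_def using d(1) by (intro ennreal_tendsto_cmult assms(9)) auto
    then have "eventually (\<lambda>n. ennreal K * emeasure lebesgue (A n) < ennreal (e / 2)) sequentially"
      by (rule order_tendstoD) (use that in simp)
    then show ?thesis
    proof (rule eventually_mono)
      fix n assume "ennreal K * emeasure lebesgue (A n) < ennreal (e / 2)"
      then have "(\<integral>\<^sup>+x. ennreal (B \<bar>w n x\<bar>) \<partial>lebesgue) \<le> ennreal (e / 2) + ennreal (e / 2)"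
        using bound[of n] by (meson add_left_mono less_imp_le order_trans)
      also have "\<dots> = ennreal e"
        using that by (simp add: ennreal_plus[symmetric] del: ennreal_plus)
      finally show "(\<integral>\<^sup>+x. ennreal (B \<bar>w n x\<bar>) \<partial>lebesgue) \<le> ennreal e" .
    qed
  qed
  show ?thesis
  proof (rule order_tendstoI)
    fix a :: ennreal assume "0 < a"
    then obtain b where b: "0 < b" "b < a"
      using dense by blast
    then obtain e where e: "b = ennreal e" "0 < e"
      by (cases b) auto
    show "eventually (\<lambda>n. (\<integral>\<^sup>+x. ennreal (B \<bar>w n x\<bar>) \<partial>lebesgue) < a) sequentially"
      by (rule eventually_mono[OF main[OF e(2)]]) (use b(2) e(1) in auto)
  qed simp
qed

end
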